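(* Let $r\ge1$ be an integer and let $z_1,\ldots,z_r\in\mathbb C$ be roots of unity, $\mathbf z=(z_1,\ldots,z_r)$. Let $V_r(\mathbf z)$ be the open set defined in the context. Then the multiple Dirichlet series $$\sum_{n_1>\cdots>n_r>0}\frac{z_1^{n_1}\cdots z_r^{n_r}}{n_1^{s_1}\cdots n_r^{s_r}}$$ converges (as the limit for $N\to\infty$ of its partial sums over $N>n_1>\cdots>n_r>0$) at every integral point $(s_1,\ldots,s_r)\in V_r(\mathbf z)\cap\mathbb Z^r$. Moreover, for every integral point $(s_1,\ldots,s_r)\in V_r(\mathbf z)\cap\mathbb Z^r$ and all non-negative integers $k_1,\ldots,k_r$, the series $$\sum_{n_1>\cdots>n_r>0}\frac{z_1^{n_1}(\log n_1)^{k_1}\cdots z_r^{n_r}(\log n_r)^{k_r}}{n_1^{s_1}\cdots n_r^{s_r}}$$ converges, in the sense that the limit $$\lim_{N\to\infty}\ \sum_{N>n_1>\cdots>n_r>0}\frac{z_1^{n_1}(\log n_1)^{k_1}\cdots z_r^{n_r}(\log n_r)^{k_r}}{n_1^{s_1}\cdots n_r^{s_r}}$$ exists.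
   Context: The indices $n_1,\ldots,n_r$ run over positive integers, and $(\log n)^0=1$. For $1\le i\le j\le r$ write $z_{[i,j]}:=z_iz_{i+1}\cdots z_j$. For $1\le j\le r$ let $I_j(\mathbf z):=\{i: 1\le i\le j,\ z_{[i,j]}=1\}$ and let $Q_j(\mathbf z):=|I_j(\mathbf z)|$ be its number of elements. Define $$V_r(\mathbf z):=\{(s_1,\ldots,s_r)\in\mathbb C^r:\ \Re(s_1+\cdots+s_i)>Q_i(\mathbf z)\ \text{ for all } 1\le i\le r\}.$$ *)

theory Defs
  imports "HOL-Analysis.Analysis"
begin

text \<open>
  An \<open>r\<close>-tuple is a function on indices \<open>1, \<dots>, r\<close>. Where tuples form a set, they are
  made extensional by \<open>\<rightarrow>\<^sub>E\<close>, so that \<open>\<complex>\<^sup>r\<close> is \<open>{1..r} \<rightarrow>\<^sub>E UNIV\<close> and \<open>\<int>\<^sup>r\<close>, as a subset of it,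
  is \<open>{1..r} \<rightarrow>\<^sub>E \<int>\<close>.
\<close>

definition root_of_unity :: "complex \<Rightarrow> bool" where
  "root_of_unity w \<longleftrightarrow> (\<exists>m::nat. m > 0 \<and> w ^ m = 1)"

definition unit_block_starts :: "(nat \<Rightarrow> complex) \<Rightarrow> nat \<Rightarrow> nat set" where
  "unit_block_starts z j = {i. 1 \<le> i \<and> i \<le> j \<and> (\<Prod>l=i..j. z l) = 1}"

definition Q :: "(nat \<Rightarrow> complex) \<Rightarrow> nat \<Rightarrow> nat" where
  "Q z j = card (unit_block_starts z j)"

definition V :: "nat \<Rightarrow> (nat \<Rightarrow> complex) \<Rightarrow> (nat \<Rightarrow> complex) set" where
  "V r z = {s \<in> {1..r} \<rightarrow>\<^sub>E UNIV. \<forall>i\<in>{1..r}. Re (\<Sum>l=1..i. s l) > real (Q z i)}"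

definition integral_points :: "nat \<Rightarrow> (nat \<Rightarrow> complex) set" where
  "integral_points r = {1..r} \<rightarrow>\<^sub>E \<int>"

text \<open>The index set \<open>N > n\<^sub>1 > \<cdots> > n\<^sub>r > 0\<close>.\<close>

definition decreasing_tuples :: "nat \<Rightarrow> nat \<Rightarrow> (nat \<Rightarrow> nat) set" where
  "decreasing_tuples r N = {n \<in> {1..r} \<rightarrow>\<^sub>E {0<..<N}. strict_antimono_on {1..r} n}"

text \<open>
  Partial sums of the two series. Since every \<open>n i\<close> is positive, \<open>powr\<close> is the usual
  principal power \<open>exp (s i * ln (n i))\<close>; also \<open>ln 1 ^ 0 = 1\<close>.
\<close>

definition multi_dirichlet_partial ::
  "nat \<Rightarrow> (nat \<Rightarrow> complex) \<Rightarrow> (nat \<Rightarrow> complex) \<Rightarrow> nat \<Rightarrow> complex" where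
  "multi_dirichlet_partial r z s N =
     (\<Sum>n\<in>decreasing_tuples r N. \<Prod>i=1..r. z i ^ n i / of_nat (n i) powr s i)"

definition multi_dirichlet_log_partial ::
  "nat \<Rightarrow> (nat \<Rightarrow> complex) \<Rightarrow> (nat \<Rightarrow> complex) \<Rightarrow> (nat \<Rightarrow> nat) \<Rightarrow> nat \<Rightarrow> complex" where
  "multi_dirichlet_log_partial r z s k N =
     (\<Sum>n\<in>decreasing_tuples r N.
        \<Prod>i=1..r. z i ^ n i * of_real (ln (real (n i))) ^ k i / of_nat (n i) powr s i)"

end

theory Submission
  imports Defs "HOL-Real_Asymp.Real_Asymp"
begin

text \<open>
  Call \<open>f\<close> a symbol of order \<open>b\<close> if its \<open>m\<close>-th difference is \<open>O(n\<^sup>b\<^sup>-\<^sup>m)\<close> for every \<open>m\<close>; for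
  instance, \<open>(ln n)\<^sup>k n\<^sup>-\<^sup>s\<close> is one of every order exceeding \<open>- Re s\<close>. If \<open>\<bar>w\<bar> = 1\<close> and \<open>f\<close> is a
  symbol of order \<open>b\<close>, then \<open>\<Sum>n<N. w\<^sup>n f n = C + w\<^sup>N h N\<close> with \<open>h\<close> a symbol of order \<open>b\<close> when
  \<open>w \<noteq> 1\<close>, and of order \<open>b + 1\<close> when \<open>w = 1\<close> and \<open>b \<noteq> -1\<close>. Summing over \<open>n\<^sub>r\<close>, then \<open>n\<^sub>r\<^sub>-\<^sub>1\<close>, and
  so on therefore shows that the multiple sum is a constant plus the sum over \<open>i\<close> of
  \<open>z\<^sub>[\<^sub>1\<^sub>,\<^sub>i\<^sub>]\<^sup>N h\<^sub>i N\<close>, where \<open>h\<^sub>i\<close> is a symbol of order \<open>Q\<^sub>i - Re (s\<^sub>1 + \<dots> + s\<^sub>i) + \<epsilon>\<close>: every step whose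
  block product is \<open>1\<close> costs one power of \<open>N\<close>. For small \<open>\<epsilon>\<close> all these
  orders are negative exactly on \<open>V\<close>.
\<close>

section \<open>Finite differences and closure properties of symbols\<close>

definition fdiff :: "(nat \<Rightarrow> complex) \<Rightarrow> nat \<Rightarrow> complex" where
  "fdiff f n = f (Suc n) - f n"

text \<open>Complex-valued, because both sides of \<open>O\<close> must have the same type. Since
  \<open>0 powr b = 0\<close>, explicit bounds are checked for positive \<open>n\<close>
  only.\<close>

abbreviation npow :: "real \<Rightarrow> nat \<Rightarrow> complex" where
  "npow b \<equiv> \<lambda>n. complex_of_real (real n powr b)"

definition symbol :: "real \<Rightarrow> (nat \<Rightarrow> complex) \<Rightarrow> bool" where
  "symbol b f \<longleftrightarrow> (\<forall>m. (fdiff ^^ m) f \<in> O(npow (b - real m)))"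

lemma npow_mono: "a \<le> b \<Longrightarrow> npow a \<in> O(npow b)"
  by (rule bigoI[of _ 1], rule eventually_mono[OF eventually_gt_at_top[of 0]])
     (simp add: powr_mono)

lemma bigo_npow_mono: "f \<in> O(npow a) \<Longrightarrow> a \<le> b \<Longrightarrow> f \<in> O(npow b)"
  using npow_mono landau_o.big_trans by blast

lemma bigo_npow_mult:
  assumes "f \<in> O(npow a)" "g \<in> O(npow b)"
  shows "(\<lambda>n. f n * g n) \<in> O(npow (a + b))"
  using landau_o.big.mult[OF assms] by (simp add: powr_add)

lemma fdiff_pow_add: "(fdiff ^^ m) (\<lambda>n. f n + g n) = (\<lambda>n. (fdiff ^^ m) f n + (fdiff ^^ m) g n)"
  by (induction m) (auto simp: fdiff_def fun_eq_iff)

lemma fdiff_pow_cmult: "(fdiff ^^ m) (\<lambda>n. c * f n) = (\<lambda>n. c * (fdiff ^^ m) f n)"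
  by (induction m) (auto simp: fdiff_def fun_eq_iff algebra_simps)

lemma symbolD: "symbol b f \<Longrightarrow> (fdiff ^^ m) f \<in> O(npow (b - real m))"
  by (simp add: symbol_def)

lemma symbol_bigo: "symbol b f \<Longrightarrow> f \<in> O(npow b)"
  using symbolD[of b f 0] by simp

lemma symbol_mono: "symbol a f \<Longrightarrow> a \<le> b \<Longrightarrow> symbol b f"
  unfolding symbol_def by (auto intro: bigo_npow_mono[of _ "a - real m" "b - real m" for m])

lemma symbol_add: "symbol b f \<Longrightarrow> symbol b g \<Longrightarrow> symbol b (\<lambda>n. f n + g n)"
  unfolding symbol_def fdiff_pow_add by (auto intro: sum_in_bigo)

lemma symbol_cmult: "symbol b f \<Longrightarrow> symbol b (\<lambda>n. c * f n)"
  unfolding symbol_def fdiff_pow_cmult by auto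

lemma symbol_fdiff: "symbol b f \<Longrightarrow> symbol (b - 1) (fdiff f)"
  unfolding symbol_def
proof
  fix m assume *: "\<forall>m. (fdiff ^^ m) f \<in> O(npow (b - real m))"
  show "(fdiff ^^ m) (fdiff f) \<in> O(npow (b - 1 - real m))"
    using *[rule_format, of "Suc m"] by (simp add: funpow_Suc_right del: funpow.simps) (simp add: algebra_simps)
qed

text \<open>Meant for partial sums: their difference is the summand, already a symbol, so only their
  own size remains to be estimated.\<close>

lemma symbol_if_fdiff:
  assumes "f \<in> O(npow b)" "symbol (b - 1) (fdiff f)"
  shows "symbol b f"
  unfolding symbol_def
proof
  fix m show "(fdiff ^^ m) f \<in> O(npow (b - real m))"
  proof (cases m)
    case (Suc k)
    then show ?thesis using symbolD[OF assms(2), of k]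
      by (simp add: funpow_Suc_right del: funpow.simps) (simp add: algebra_simps)
  qed (use assms in simp)
qed

lemma symbol_Suc:
  assumes "symbol b f"
  shows "symbol b (\<lambda>n. f (Suc n))"
proof -
  have "symbol b (\<lambda>n. f n + fdiff f n)"
    by (intro symbol_add assms symbol_mono[OF symbol_fdiff[OF assms]]) simp
  then show ?thesis by (simp add: fdiff_def)
qed

text \<open>By the discrete Leibniz rule the difference of a product is a sum of two products, each
  with one factor differenced and its order lowered by one. The induction on \<open>m\<close>
  therefore ranges over all factors and orders.\<close>

lemma symbol_mult:
  assumes "symbol a f" "symbol b g"
  shows "symbol (a + b) (\<lambda>n. f n * g n)"
  unfolding symbol_def
proof
  fix m show "(fdiff ^^ m) (\<lambda>n. f n * g n) \<in> O(npow (a + b - real m))"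
    using assms
  proof (induction m arbitrary: a b f g)
    case 0
    then show ?case using bigo_npow_mult[OF symbol_bigo symbol_bigo] by simp
  next
    case (Suc m)
    have "fdiff (\<lambda>n. f n * g n) = (\<lambda>n. fdiff f n * g n + f (Suc n) * fdiff g n)"
      by (simp add: fdiff_def fun_eq_iff algebra_simps)
    then have eq: "(fdiff ^^ Suc m) (\<lambda>n. f n * g n) =
       (\<lambda>n. (fdiff ^^ m) (\<lambda>n. fdiff f n * g n) n + (fdiff ^^ m) (\<lambda>n. f (Suc n) * fdiff g n) n)"
      by (simp add: funpow_Suc_right fdiff_pow_add del: funpow.simps)
    have "(fdiff ^^ m) (\<lambda>n. fdiff f n * g n) \<in> O(npow (a + b - real (Suc m)))"
      using Suc.IH[OF symbol_fdiff[OF Suc.prems(1)] Suc.prems(2)] by (simp add: algebra_simps)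
    moreover have "(fdiff ^^ m) (\<lambda>n. f (Suc n) * fdiff g n) \<in> O(npow (a + b - real (Suc m)))"
      using Suc.IH[OF symbol_Suc[OF Suc.prems(1)] symbol_fdiff[OF Suc.prems(2)]] by (simp add: algebra_simps)
    ultimately show ?case unfolding eq by (rule sum_in_bigo)
  qed
qed

lemma symbol_const: "symbol 0 (\<lambda>n. c)"
proof -
  have "(fdiff ^^ Suc m) (\<lambda>n. c) = (\<lambda>n. 0)" for m
    by (induction m) (auto simp: fdiff_def fun_eq_iff)
  then have "(fdiff ^^ m) (\<lambda>n. c) \<in> O(npow (0 - real m))" for m
  proof (cases m)
    case 0
    then show ?thesis
      by (auto intro!: bigoI[of _ "norm c"] eventually_mono[OF eventually_gt_at_top[of 0]])
  qed (use \<open>\<And>m. (fdiff ^^ Suc m) (\<lambda>n. c) = (\<lambda>n. 0)\<close> in \<open>simp del: funpow.simps\<close>)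
  then show ?thesis by (simp add: symbol_def)
qed

lemma symbol_power: "symbol b f \<Longrightarrow> symbol (real k * b) (\<lambda>n. f n ^ k)"
  by (induction k) (auto simp: symbol_const algebra_simps dest: symbol_mult)

section \<open>Powers and logarithms as symbols\<close>

text \<open>
  Mean value theorem, iterated: differences commute with differentiation in the base point \<open>x\<close>.
\<close>

lemma norm_fdiff_pow_le:
  fixes F :: "nat \<Rightarrow> real \<Rightarrow> complex"
  assumes deriv: "\<And>m x. x > 0 \<Longrightarrow> (F m has_vector_derivative F (Suc m) x) (at x)"
    and "x > 0" and "\<And>t. x \<le> t \<Longrightarrow> t \<le> x + real m \<Longrightarrow> norm (F m t) \<le> B"
  shows "norm ((fdiff ^^ m) (\<lambda>n. F 0 (x + real n)) 0) \<le> B"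
proof -
  define D where "D j k x = (fdiff ^^ k) (\<lambda>n. F j (x + real n)) 0" for j k x
  have shift: "(fdiff ^^ k) (\<lambda>n. f (Suc n)) = (\<lambda>n. (fdiff ^^ k) f (Suc n))" for f k
    by (induction k) (auto simp: fdiff_def fun_eq_iff)
  \<comment> \<open>Shifting the index by one shifts the base point by one, so the last difference
    can be taken in \<open>x\<close>, where the mean value theorem applies.\<close>
  have D_Suc: "D j (Suc k) x = D j k (x + 1) - D j k x" for j k x
    using shift[of k "\<lambda>n. F j (x + real n)"]
    by (simp add: D_def fdiff_def algebra_simps)
  have D_0: "D j 0 x = F j x" for j x
    by (simp add: D_def)
  have D_deriv: "(D j k has_vector_derivative D (Suc j) k x) (at x)" if "x > 0" for j k x
    using that
  proof (induction k arbitrary: x)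
    case 0
    then show ?case using deriv[of x j] by (simp add: D_0[abs_def])
  next
    case (Suc k)
    have "((\<lambda>x. D j k (x + 1)) has_vector_derivative D (Suc j) k (x + 1)) (at x)"
    proof -
      have "(D j k \<circ> (\<lambda>x. x + 1) has_vector_derivative 1 *\<^sub>R D (Suc j) k (x + 1)) (at x)"
        using Suc by (intro vector_diff_chain_at) (auto intro!: derivative_eq_intros)
      then show ?thesis by (simp add: o_def)
    qed
    from has_vector_derivative_diff[OF this Suc.IH[OF Suc.prems]]
    show ?case by (simp add: D_Suc[abs_def])
  qed
  have "norm (D j k x) \<le> B" if "x > 0" "\<And>t. x \<le> t \<Longrightarrow> t \<le> x + real k \<Longrightarrow> norm (F (j + k) t) \<le> B" for j k x
    using that
  proof (induction k arbitrary: j x)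
    case 0
    then show ?case by (simp add: D_0)
  next
    case (Suc k)
    have cont: "continuous_on {x..x+1} (D j k)"
      using Suc.prems(1)
      by (intro continuous_at_imp_continuous_on ballI has_vector_derivative_continuous[OF D_deriv]) auto
    have "\<exists>y\<in>{x<..<x+1}. norm (D j k (x + 1) - D j k x) \<le> norm ((x + 1 - x) *\<^sub>R D (Suc j) k y)"
      using D_deriv Suc.prems(1)
      by (intro mvt_general[where f' = "\<lambda>y h. h *\<^sub>R D (Suc j) k y"] cont)
         (auto simp: has_vector_derivative_def)
    then obtain y where y: "y \<in> {x<..<x+1}" "norm (D j k (x + 1) - D j k x) \<le> norm (D (Suc j) k y)"
      by auto
    \<comment> \<open>The range from \<open>y\<close> to \<open>y + real k\<close> lies within that
      from \<open>x\<close> to \<open>x + real (Suc k)\<close>, and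
      \<open>Suc j + k = j + Suc k\<close>.\<close>
    have "norm (D (Suc j) k y) \<le> B"
      using y Suc.prems by (intro Suc.IH) auto
    with y(2) have "norm (D j k (x + 1) - D j k x) \<le> B" by simp
    then show ?case by (simp add: D_Suc)
  qed
  from this[of x m 0] assms show ?thesis by (simp add: D_def)
qed

text \<open>The \<open>m\<close>-th difference at \<open>n\<close> is controlled by the
  \<open>m\<close>-th derivative between \<open>n\<close> and \<open>n + m\<close>, where the
  argument stays within a constant factor of \<open>n\<close>.\<close>

lemma symbol_real_function:
  fixes F :: "nat \<Rightarrow> real \<Rightarrow> complex"
  assumes deriv: "\<And>m x. x > 0 \<Longrightarrow> (F m has_vector_derivative F (Suc m) x) (at x)"
    and bound: "\<And>m. \<exists>C. \<forall>x\<ge>1. norm (F m x) \<le> C * x powr (b - real m)"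
  shows "symbol b (\<lambda>n. F 0 (real n))"
  unfolding symbol_def
proof
  fix m
  obtain C where C: "\<And>x. x \<ge> 1 \<Longrightarrow> norm (F m x) \<le> C * x powr (b - real m)"
    using bound[of m] by blast
  have C0: "C \<ge> 0" using C[of 1] norm_ge_zero[of "F m 1"] by (simp del: norm_ge_zero)
  \<comment> \<open>For \<open>n > 0\<close> and \<open>n \<le> t \<le> n + m\<close> the ratio
    \<open>t / n\<close> lies between \<open>1\<close> and \<open>m + 1\<close>; the absolute value
    covers both signs of the exponent.\<close>
  define K where "K = C * real (Suc m) powr \<bar>b - real m\<bar>"
  have shift: "(fdiff ^^ k) f n = (fdiff ^^ k) (\<lambda>i. f (n + i)) 0" for f k n
  proof -
    have "(fdiff ^^ k) (\<lambda>i. f (n + i)) = (\<lambda>i. (fdiff ^^ k) f (n + i))"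
      by (induction k) (auto simp: fdiff_def fun_eq_iff)
    then show ?thesis by simp
  qed
  have "norm ((fdiff ^^ m) (\<lambda>n. F 0 (real n)) n) \<le> K * norm (npow (b - real m) n)" if n: "n > 0" for n
  proof -
    have "norm ((fdiff ^^ m) (\<lambda>i. F 0 (real n + real i)) 0) \<le> K * real n powr (b - real m)"
    proof (rule norm_fdiff_pow_le[where F = F])
      fix t assume t: "real n \<le> t" "t \<le> real n + real m"
      have n1: "real n \<ge> 1" using n by simp
      define q where "q = t / real n"
      have q: "1 \<le> q" "q \<le> real (Suc m)" "t = q * real n"
      proof -
        have "real m * 1 \<le> real m * real n" using n1 by (intro mult_left_mono) auto
        then show "q \<le> real (Suc m)" using t n1 by (simp add: q_def field_simps)
      qed (use t n1 in \<open>auto simp: q_def field_simps\<close>)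
      have "q powr (b - real m) \<le> q powr \<bar>b - real m\<bar>"
        using q by (intro powr_mono) auto
      also have "\<dots> \<le> real (Suc m) powr \<bar>b - real m\<bar>"
        using q by (intro powr_mono2) auto
      finally have "t powr (b - real m) \<le> real (Suc m) powr \<bar>b - real m\<bar> * real n powr (b - real m)"
        using q n1 by (simp add: powr_mult mult_right_mono)
      then have "C * t powr (b - real m) \<le> K * real n powr (b - real m)"
        using C0 unfolding K_def mult.assoc by (rule mult_left_mono)
      with C[of t] t n1 show "norm (F m t) \<le> K * real n powr (b - real m)" by simp
    qed (use n deriv in auto)
    then show ?thesis
      by (subst shift) simp
  qed
  then show "(fdiff ^^ m) (\<lambda>n. F 0 (real n)) \<in> O(npow (b - real m))"
    by (intro bigoI[of _ K] eventually_mono[OF eventually_gt_at_top[of 0]])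
qed

lemma symbol_powr: "symbol (Re s) (\<lambda>n. of_nat n powr s)"
proof -
  define F where "F m x = (\<Prod>i<m. s - of_nat i) * of_real x powr (s - of_nat m)" for m :: nat and x :: real
  have "symbol (Re s) (\<lambda>n. F 0 (real n))"
  proof (rule symbol_real_function)
    fix m :: nat and x :: real assume x: "x > 0"
    have "((\<lambda>x. of_real x powr (s - of_nat m)) has_vector_derivative
        (s - of_nat m) * of_real x powr (s - of_nat m - 1)) (at x)"
      by (rule has_vector_derivative_real_field, rule has_field_derivative_powr) (use x in \<open>auto simp: complex_nonpos_Reals_iff\<close>)
    then have "((\<lambda>x. (\<Prod>i<m. s - of_nat i) * of_real x powr (s - of_nat m)) has_vector_derivative
        (\<Prod>i<m. s - of_nat i) * ((s - of_nat m) * of_real x powr (s - of_nat m - 1))) (at x)"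
      by (rule has_vector_derivative_mult_right)
    then show "(F m has_vector_derivative F (Suc m) x) (at x)"
      by (simp add: F_def[abs_def] algebra_simps)
  next
    fix m
    show "\<exists>C. \<forall>x\<ge>1. norm (F m x) \<le> C * x powr (Re s - real m)"
      by (rule exI[of _ "norm (\<Prod>i<m. s - of_nat i)"]) (auto simp: F_def norm_mult norm_powr_real_powr)
  qed
  then show ?thesis by (simp add: F_def)
qed

text \<open>Only the function itself needs the excess \<open>e\<close>, through
  \<open>ln x \<le> x powr e / e\<close>; for \<open>m > 0\<close> the \<open>m\<close>-th
  derivative is a multiple of \<open>x powr (- m)\<close>.\<close>

lemma symbol_ln:
  assumes "e > 0"
  shows "symbol e (\<lambda>n. of_real (ln (real n)))"
proof -
  define F where "F m x = (if m = 0 then ln x else (\<Prod>i=1..<m. - real i) * x powr (- real m))"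
    for m :: nat and x :: real
  have "symbol e (\<lambda>n. complex_of_real (F 0 (real n)))"
  proof (rule symbol_real_function[where F = "\<lambda>m x. complex_of_real (F m x)"])
    fix m :: nat and x :: real assume x: "x > 0"
    have "(F m has_real_derivative F (Suc m) x) (at x)"
    proof (cases "m = 0")
      case True
      then show ?thesis using x
        by (auto simp: F_def[abs_def] powr_minus field_simps intro!: derivative_eq_intros)
    next
      case False
      then have "(\<Prod>i=1..<Suc m. - real i) = (\<Prod>i=1..<m. - real i) * (- real m)"
        by (subst prod.atLeastLessThan_Suc) auto
      moreover have "((\<lambda>x. (\<Prod>i=1..<m. - real i) * x powr (- real m)) has_real_derivative
          (\<Prod>i=1..<m. - real i) * (- real m * x powr (- real m - 1))) (at x)"
        using x by (auto intro!: derivative_eq_intros)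
      moreover have "- real m - 1 = - real (Suc m)" by simp
      ultimately show ?thesis using False
        unfolding F_def by (simp only: mult.assoc if_False nat.distinct)
    qed
    then show "((\<lambda>x. complex_of_real (F m x)) has_vector_derivative complex_of_real (F (Suc m) x)) (at x)"
      by (intro has_vector_derivative_of_real) (simp add: has_real_derivative_iff_has_vector_derivative)
  next
    fix m
    show "\<exists>C. \<forall>x\<ge>1. norm (complex_of_real (F m x)) \<le> C * x powr (e - real m)"
    proof (cases "m = 0")
      case True
      show ?thesis
        using ln_powr_bound[OF _ assms] True
        by (intro exI[of _ "1 / e"]) (auto simp: F_def)
    next
      case False
      have "x powr (- real m) \<le> x powr (e - real m)" if "x \<ge> 1" for x
        using that assms by (intro powr_mono) auto
      moreover define P where "P = (\<Prod>i=1..<m. - real i)"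
      moreover have "norm (complex_of_real (F m x)) = \<bar>P\<bar> * x powr (- real m)" for x
        using False unfolding F_def P_def
        by (simp only: if_False norm_of_real abs_mult abs_of_nonneg[OF powr_ge_zero])
      ultimately show ?thesis
        by (intro exI[of _ "\<bar>P\<bar>"]) (simp add: mult_left_mono)
    qed
  qed
  then show ?thesis by (simp add: F_def)
qed

section \<open>Power bounds for partial sums\<close>

text \<open>Replaces a power bound by the increments of \<open>n powr d\<close>, asymptotic to
  \<open>d * n powr (d - 1)\<close>, so that sums of the bounds telescope. The absolute value admits
  negative \<open>d\<close>.\<close>

lemma bigo_npowE:
  assumes "f \<in> O(npow (d - 1))" "d \<noteq> 0"
  obtains K N0 where "K > 0"
    "\<And>n. n \<ge> N0 \<Longrightarrow> norm (f n) \<le> K * \<bar>real (Suc n) powr d - real n powr d\<bar>"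
proof -
  have "(\<lambda>n. real n powr (d - 1)) \<in> O(\<lambda>n. real (Suc n) powr d - real n powr d)"
    using assms(2) by (cases "d > 0"; real_asymp)
  then have "npow (d - 1) \<in> O(\<lambda>n. complex_of_real (real (Suc n) powr d - real n powr d))"
    by (subst landau_o.big.norm_iff[symmetric]) (simp del: of_real_diff)
  with assms(1) have "f \<in> O(\<lambda>n. complex_of_real (real (Suc n) powr d - real n powr d))"
    using landau_o.big_trans by blast
  then obtain K where "K > 0" "eventually (\<lambda>n. norm (f n) \<le> K * norm (complex_of_real (real (Suc n) powr d - real n powr d))) sequentially"
    by (elim landau_o.bigE)
  then show ?thesis using that
    unfolding eventually_sequentially norm_of_real by blast
qed

lemma bigo_partial_sum:
  assumes "f \<in> O(npow c)" "c > -1"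
  shows "(\<lambda>N. \<Sum>n<N. f n) \<in> O(npow (c + 1))"
proof -
  define d where "d = c + 1"
  have d: "d > 0" "f \<in> O(npow (d - 1))" using assms by (auto simp: d_def)
  obtain K N0 where K: "K > 0"
    "\<And>n. n \<ge> N0 \<Longrightarrow> norm (f n) \<le> K * \<bar>real (Suc n) powr d - real n powr d\<bar>"
    using bigo_npowE[OF d(2)] d(1) by (metis less_irrefl)
  have K': "norm (f n) \<le> K * (real (Suc n) powr d - real n powr d)" if "n \<ge> N0" for n
  proof -
    have "real n powr d \<le> real (Suc n) powr d" using d by (intro powr_mono2) auto
    then show ?thesis using K(2)[OF that] by simp
  qed
  \<comment> \<open>\<open>A\<close> collects the terms before the increments dominate; it is
    absorbed below because \<open>N powr d \<ge> 1\<close> for \<open>N \<ge> 1\<close> and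
    \<open>d > 0\<close>.\<close>
  define A where "A = norm (\<Sum>n<N0. f n)"
  have le: "norm (\<Sum>n<N. f n) \<le> A + K * real N powr d" if "N \<ge> N0" for N
    using that
  proof (induction N rule: dec_induct)
    case base
    then show ?case using K(1) by (simp add: A_def)
  next
    case (step N)
    have "norm (\<Sum>n<Suc N. f n) \<le> norm (\<Sum>n<N. f n) + norm (f N)"
      by (simp add: norm_triangle_ineq)
    with step K'[of N] show ?case by (simp add: algebra_simps)
  qed
  have "norm (\<Sum>n<N. f n) \<le> (A + K) * norm (npow d N)" if "N \<ge> max N0 1" for N
  proof -
    have "A * 1 \<le> A * real N powr d"
      using that d by (intro mult_left_mono ge_one_powr_ge_zero) (auto simp: A_def)
    with le[of N] that show ?thesis by (simp add: algebra_simps)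
  qed
  then have "(\<lambda>N. \<Sum>n<N. f n) \<in> O(npow d)"
    by (intro bigoI[of _ "A + K"] eventually_mono[OF eventually_ge_at_top[of "max N0 1"]]) simp
  then show ?thesis by (simp add: d_def)
qed

lemma bigo_summable_norm:
  assumes "f \<in> O(npow c)" "c < -1"
  shows "summable (\<lambda>n. norm (f n))"
proof (rule summable_comparison_test_bigo)
  show "summable (\<lambda>n. norm (real n powr c))"
    using assms(2) by (simp add: summable_real_powr_iff)
  show "(\<lambda>n. norm (f n)) \<in> O(\<lambda>n. real n powr c)"
    using assms(1) by (subst (asm) landau_o.big.norm_iff[symmetric]) simp
qed

section \<open>Tail sums\<close>

text \<open>
  The tail \<open>\<Sum>n\<ge>N. w\<^sup>n f n\<close> divided by \<open>w\<^sup>N\<close>; with this normalisation \<open>fdiff\<close> commutes with \<open>tail_sum w\<close>.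
\<close>

definition tail_sum :: "complex \<Rightarrow> (nat \<Rightarrow> complex) \<Rightarrow> nat \<Rightarrow> complex" where
  "tail_sum w f N = (\<Sum>n. w ^ n * f (n + N))"

lemma summable_tail:
  assumes "f \<in> O(npow c)" "c < -1" "norm w = 1"
  shows "summable (\<lambda>n. norm (w ^ n * f (n + N)))"
  using bigo_summable_norm[OF assms(1,2)] assms(3)
  by (simp add: norm_mult norm_power summable_iff_shift[of "\<lambda>n. norm (f n)"])

lemma bigo_tail_sum:
  assumes "f \<in> O(npow c)" "c < -1" "norm w = 1"
  shows "tail_sum w f \<in> O(npow (c + 1))"
proof -
  define d where "d = c + 1"
  have d: "d < 0" "f \<in> O(npow (d - 1))" using assms by (auto simp: d_def)
  obtain K N0 where K: "K > 0"
    "\<And>n. n \<ge> N0 \<Longrightarrow> norm (f n) \<le> K * \<bar>real (Suc n) powr d - real n powr d\<bar>"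
    using bigo_npowE[OF d(2)] d(1) by (metis less_irrefl)
  have "norm (tail_sum w f N) \<le> K * norm (npow d N)" if N: "N \<ge> max N0 1" for N
  proof -
    \<comment> \<open>As \<open>d < 0\<close>, the bounds over the whole tail telescope to
      \<open>K * N powr d\<close>.\<close>
    have "(\<lambda>n. real (n + N) powr d) \<longlonglongrightarrow> 0"
      using d(1) by (intro tendsto_neg_powr filterlim_compose[OF filterlim_real_sequentially])
        (auto simp: filterlim_add_const_nat_at_top)
    from telescope_sums'[OF this]
    have "(\<lambda>n. real (n + N) powr d - real (Suc n + N) powr d) sums real N powr d" by simp
    from sums_mult[OF this, of K]
    have sums: "(\<lambda>n. K * (real (n + N) powr d - real (Suc n + N) powr d)) sums (K * real N powr d)" .
    have "norm (w ^ n * f (n + N)) \<le> K * (real (n + N) powr d - real (Suc n + N) powr d)" for n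
    proof -
      have "real (Suc (n + N)) powr d \<le> real (n + N) powr d"
        using d N by (intro powr_mono2') auto
      with K(2)[of "n + N"] N assms(3) show ?thesis by (simp add: norm_mult norm_power)
    qed
    then have "(\<Sum>n. norm (w ^ n * f (n + N))) \<le> K * real N powr d"
      unfolding sums_unique[OF sums]
      by (intro suminf_le summable_tail[OF assms] sums_summable[OF sums])
    then show ?thesis unfolding tail_sum_def
      using summable_norm[OF summable_tail[OF assms, of N]] by simp
  qed
  then have "tail_sum w f \<in> O(npow d)"
    by (intro bigoI[of _ K] eventually_mono[OF eventually_ge_at_top[of "max N0 1"]])
  then show ?thesis by (simp add: d_def)
qed

lemma tail_sum_Suc:
  assumes "f \<in> O(npow c)" "c < -1" "norm w = 1"
  shows "tail_sum w f N = f N + w * tail_sum w f (Suc N)"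
proof -
  have sm: "summable (\<lambda>n. w ^ n * f (n + M))" for M
    by (rule summable_norm_cancel[OF summable_tail[OF assms]])
  have "(\<Sum>n. w ^ Suc n * f (Suc n + N)) = tail_sum w f N - f N"
    unfolding tail_sum_def using suminf_split_head[OF sm[of N]] by simp
  moreover have "(\<Sum>n. w ^ Suc n * f (Suc n + N)) = w * tail_sum w f (Suc N)"
    unfolding tail_sum_def suminf_mult[OF sm[of "Suc N"], symmetric]
    by (simp add: mult.assoc)
  ultimately show ?thesis by (metis add.commute diff_add_cancel)
qed

lemma fdiff_pow_tail_sum:
  assumes "symbol c f" "c < -1" "norm w = 1"
  shows "(fdiff ^^ m) (tail_sum w f) = tail_sum w ((fdiff ^^ m) f)"
proof (induction m)
  case (Suc m)
  have "(fdiff ^^ m) f \<in> O(npow c)"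
    using symbolD[OF assms(1), of m] by (rule bigo_npow_mono) simp
  then have sm: "summable (\<lambda>n. w ^ n * (fdiff ^^ m) f (n + N))" for N
    by (intro summable_norm_cancel[OF summable_tail[OF _ assms(2,3)]])
  have "fdiff (tail_sum w ((fdiff ^^ m) f)) N = tail_sum w (fdiff ((fdiff ^^ m) f)) N" for N
    unfolding fdiff_def[of "tail_sum w _"] tail_sum_def suminf_diff[OF sm sm]
    by (simp add: fdiff_def right_diff_distrib)
  then show ?case using Suc by auto
qed simp

text \<open>Differences pass to the summand, so each is settled by the absolute estimate
  \<open>bigo_tail_sum\<close>, which raises the order by one and ignores cancellation.\<close>

lemma symbol_tail_sum_1:
  assumes "symbol c f" "c < -1" "norm w = 1"
  shows "symbol (c + 1) (tail_sum w f)"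
  unfolding symbol_def fdiff_pow_tail_sum[OF assms]
proof
  fix m show "tail_sum w ((fdiff ^^ m) f) \<in> O(npow (c + 1 - real m))"
    using bigo_tail_sum[OF symbolD[OF assms(1), of m] _ assms(3)] assms(2)
    by (simp add: algebra_simps)
qed

text \<open>Oscillation recovers the lost power: solving the recursion of the tail, by dividing by
  \<open>1 - w\<close>, expresses it through \<open>f\<close> and the tail of
  \<open>fdiff f\<close>, which starts one order lower.\<close>

lemma symbol_tail_sum:
  assumes "symbol c f" "c < -1" "norm w = 1" "w \<noteq> 1"
  shows "symbol c (tail_sum w f)"
proof -
  have *: "tail_sum w f N = (1 / (1 - w)) * f N + (w / (1 - w)) * tail_sum w (fdiff f) N" for N
  proof -
    have "tail_sum w f N = f N + w * (tail_sum w f N + fdiff (tail_sum w f) N)"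
      using tail_sum_Suc[OF symbol_bigo[OF assms(1)] assms(2,3), of N] by (simp add: fdiff_def)
    moreover have "fdiff (tail_sum w f) = tail_sum w (fdiff f)"
      using fdiff_pow_tail_sum[OF assms(1-3), of 1] by simp
    ultimately have "(1 - w) * tail_sum w f N = f N + w * tail_sum w (fdiff f) N"
      by (simp add: algebra_simps)
    then have "tail_sum w f N = (f N + w * tail_sum w (fdiff f) N) / (1 - w)"
      using assms(4) by (simp add: nonzero_eq_divide_eq mult.commute)
    then show ?thesis by (simp add: add_divide_distrib)
  qed
  have "symbol c (tail_sum w (fdiff f))"
    using symbol_tail_sum_1[OF symbol_fdiff[OF assms(1)] _ assms(3)] assms(2) by simp
  then have "symbol c (\<lambda>N. (1 / (1 - w)) * f N + (w / (1 - w)) * tail_sum w (fdiff f) N)"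
    by (intro symbol_add symbol_cmult assms(1))
  then show ?thesis using * by presburger
qed

lemma partial_sum_eq_tail_sum:
  assumes "symbol c f" "c < -1" "norm w = 1"
  shows "(\<Sum>n<N. w ^ n * f n) = tail_sum w f 0 + w ^ N * (- 1 * tail_sum w f N)"
proof (induction N)
  case (Suc N)
  show ?case
    using Suc tail_sum_Suc[OF symbol_bigo[OF assms(1)] assms(2,3), of N]
    by (simp add: algebra_simps)
qed simp

section \<open>Partial sums of a symbol against powers of \<open>w\<close>\<close>

text \<open>Summation by parts trades \<open>f\<close> for \<open>fdiff f\<close>, one order lower,
  until the order is below \<open>-1\<close>; there the constant is the full series and the rest a
  tail.\<close>

lemma partial_sum_twisted:
  assumes "symbol b f" "norm w = 1" "w \<noteq> 1"
  shows "\<exists>C h. symbol b h \<and> (\<forall>N. (\<Sum>n<N. w ^ n * f n) = C + w ^ N * h N)"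
proof -
  \<comment> \<open>\<open>M\<close> bounds the number of summations by parts: at
    \<open>M = 0\<close> the order is below \<open>-1\<close>.\<close>
  obtain M :: nat where "b + 1 < real M" using reals_Archimedean2 by blast
  then show ?thesis using assms(1)
  proof (induction M arbitrary: b f)
    case 0
    then have "b < -1" by simp
    with 0 show ?case
      using symbol_cmult[OF symbol_tail_sum[OF 0(2) _ assms(2,3)]]
        partial_sum_eq_tail_sum[OF 0(2) _ assms(2)] by blast
  next
    case (Suc M)
    obtain C h where h: "symbol (b - 1) h" "\<And>N. (\<Sum>n<N. w ^ n * fdiff f n) = C + w ^ N * h N"
      using Suc.IH[OF _ symbol_fdiff[OF Suc.prems(2)]] Suc.prems(1) by auto
    \<comment> \<open>Telescoping of \<open>w ^ n * f n\<close>, whose increment is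
      \<open>(w - 1) * w ^ n * f n + w * w ^ n * fdiff f n\<close>.\<close>
    have parts: "(w - 1) * (\<Sum>n<N. w ^ n * f n) = w ^ N * f N - f 0 - w * (\<Sum>n<N. w ^ n * fdiff f n)" for N
      by (induction N) (auto simp: fdiff_def algebra_simps)
    have "(\<Sum>n<N. w ^ n * f n) = (- (f 0 + w * C) / (w - 1)) +
        w ^ N * ((1 / (w - 1)) * f N + (- w / (w - 1)) * h N)" for N
    proof -
      have "(\<Sum>n<N. w ^ n * f n) = (w ^ N * f N - f 0 - w * (C + w ^ N * h N)) / (w - 1)"
        using parts[of N] h(2)[of N] assms(3) by (simp add: field_simps)
      then show ?thesis
        by (simp add: diff_divide_distrib add_divide_distrib algebra_simps)
    qed
    moreover have "symbol b (\<lambda>N. (1 / (w - 1)) * f N + (- w / (w - 1)) * h N)"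
      using h(1) by (intro symbol_add symbol_cmult Suc.prems(2)) (auto intro: symbol_mono)
    ultimately show ?case by blast
  qed
qed

text \<open>Below order \<open>-1\<close> the constant is the full series. Above it the partial sum
  is itself a symbol, being of the right size with \<open>f\<close> as its difference, so the
  constant can be \<open>0\<close>.\<close>

lemma partial_sum_untwisted:
  assumes "symbol b f" "b \<noteq> -1"
  shows "\<exists>C h. symbol (b + 1) h \<and> (\<forall>N. (\<Sum>n<N. f n) = C + h N)"
proof (cases "b < -1")
  case True
  then show ?thesis
    using symbol_cmult[OF symbol_tail_sum_1[OF assms(1) True, of 1], of "-1"]
      partial_sum_eq_tail_sum[OF assms(1) True, of 1] by fastforce
next
  case False
  have "symbol (b + 1) (\<lambda>N. \<Sum>n<N. f n)"
  proof (rule symbol_if_fdiff)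
    show "(\<lambda>N. \<Sum>n<N. f n) \<in> O(npow (b + 1))"
      using bigo_partial_sum[OF symbol_bigo[OF assms(1)]] False assms(2) by simp
    have "fdiff (\<lambda>N. \<Sum>n<N. f n) = f"
      by (simp add: fdiff_def fun_eq_iff)
    then show "symbol (b + 1 - 1) (fdiff (\<lambda>N. \<Sum>n<N. f n))"
      using assms(1) by simp
  qed
  then show ?thesis by (intro exI[of _ 0] exI[of _ "\<lambda>N. \<Sum>n<N. f n"]) simp
qed

text \<open>The conditional \<open>1\<close> is the power of \<open>N\<close> counted later, once
  for each block with product \<open>1\<close>.\<close>

lemma partial_sum_symbol:
  assumes "symbol a f" "norm w = 1" "a < b"
  shows "\<exists>C h. symbol (b + (if w = 1 then 1 else 0)) h \<and> (\<forall>N. (\<Sum>n<N. w ^ n * f n) = C + w ^ N * h N)"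
proof (cases "w = 1")
  case True
  \<comment> \<open>Order \<open>-1\<close> would produce a logarithm; the gap between \<open>a\<close> and \<open>b\<close> leaves room to avoid it.\<close>
  obtain c where c: "a \<le> c" "c \<le> b" "c \<noteq> -1"
    using assms(3) by (metis dense less_eq_real_def order_less_irrefl)
  obtain C h where "symbol (c + 1) h" "\<forall>N. (\<Sum>n<N. f n) = C + h N"
    using partial_sum_untwisted[OF symbol_mono[OF assms(1) c(1)] c(3)] by blast
  then show ?thesis using True c symbol_mono[of "c + 1" h "b + 1"] by auto
next
  case False
  then show ?thesis
    using partial_sum_twisted[OF symbol_mono[OF assms(1), of b]] assms by auto
qed

section \<open>Iterated summation over decreasing tuples\<close>

text \<open>
  The tuples \<open>N > n\<^sub>j > \<cdots> > n\<^sub>r > 0\<close>, indexed by \<open>j, \<dots>, r\<close> so that peeling off the outermost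
  summation variable needs no reindexing.
\<close>

definition chains :: "nat \<Rightarrow> nat \<Rightarrow> nat \<Rightarrow> (nat \<Rightarrow> nat) set" where
  "chains j r N = {n \<in> {j..r} \<rightarrow>\<^sub>E {0<..<N}. strict_antimono_on {j..r} n}"

lemma finite_chains: "finite (chains j r N)"
  unfolding chains_def by (rule finite_subset[of _ "{j..r} \<rightarrow>\<^sub>E {0<..<N}"]) (auto intro: finite_PiE)

lemma sum_chains_Suc:
  fixes f :: "nat \<Rightarrow> nat \<Rightarrow> complex"
  assumes "j \<le> r"
  shows "(\<Sum>n\<in>chains j r N. \<Prod>i=j..r. f i (n i)) =
    (\<Sum>m\<in>{0<..<N}. f j m * (\<Sum>n\<in>chains (Suc j) r m. \<Prod>i=Suc j..r. f i (n i)))"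
proof -
  have split: "{j..r} = insert j {Suc j..r}" using assms by auto
  have "(\<Sum>m\<in>{0<..<N}. f j m * (\<Sum>n\<in>chains (Suc j) r m. \<Prod>i=Suc j..r. f i (n i))) =
    (\<Sum>(m, n)\<in>Sigma {0<..<N} (chains (Suc j) r). f j m * (\<Prod>i=Suc j..r. f i (n i)))"
    by (simp add: sum_distrib_left sum.Sigma finite_chains)
  also have "\<dots> = (\<Sum>n\<in>chains j r N. \<Prod>i=j..r. f i (n i))"
  \<comment> \<open>A tuple is its outermost entry and the rest; resetting index \<open>j\<close> to
    \<open>undefined\<close> makes the rest extensional on \<open>{Suc j..r}\<close>.\<close>
  proof (rule sum.reindex_bij_witness[of _ "\<lambda>n. (n j, n(j := undefined))" "\<lambda>(m, n). n(j := m)"])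
    fix p assume "p \<in> Sigma {0<..<N} (chains (Suc j) r)"
    then obtain m n where p: "p = (m, n)" "m \<in> {0<..<N}" "n \<in> chains (Suc j) r m" by auto
    then have n: "n \<in> {Suc j..r} \<rightarrow>\<^sub>E {0<..<m}" "strict_antimono_on {Suc j..r} n"
      by (auto simp: chains_def)
    have nj: "n j = undefined" using n(1) by (auto simp: PiE_def extensional_def)
    show "(\<lambda>n. (n j, n(j := undefined))) ((\<lambda>(m, n). n(j := m)) p) = p"
      using nj by (auto simp: p)
    have "n \<in> {Suc j..r} \<rightarrow>\<^sub>E {0<..<N}"
      by (rule subsetD[OF PiE_mono n(1)]) (use p(2) in auto)
    then have "n(j := m) \<in> {j..r} \<rightarrow>\<^sub>E {0<..<N}"
      unfolding split by (rule PiE_fun_upd[rotated]) (rule p(2))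
    moreover have "strict_antimono_on {j..r} (n(j := m))"
      using n unfolding split monotone_on_def by (auto simp: PiE_iff)
    ultimately show "(\<lambda>(m, n). n(j := m)) p \<in> chains j r N" by (simp add: p chains_def)
    show "(\<Prod>i=j..r. f i (((\<lambda>(m, n). n(j := m)) p) i)) =
      (case p of (m, n) \<Rightarrow> f j m * (\<Prod>i=Suc j..r. f i (n i)))"
      unfolding split by (auto simp: p intro!: prod.cong)
  next
    fix n assume "n \<in> chains j r N"
    then have n: "n \<in> {j..r} \<rightarrow>\<^sub>E {0<..<N}" "strict_antimono_on {j..r} n"
      by (auto simp: chains_def)
    show "(\<lambda>(m, n). n(j := m)) (n j, n(j := undefined)) = n" by simp
    have "n(j := undefined) \<in> {Suc j..r} \<rightarrow>\<^sub>E {0<..<N}"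
      using n(1) unfolding split by (intro fun_upd_in_PiE) auto
    moreover have "n i < n j" if "i \<in> {Suc j..r}" for i
      using monotone_onD[OF n(2), of j i] that by auto
    ultimately have "n(j := undefined) \<in> {Suc j..r} \<rightarrow>\<^sub>E {0<..<n j}"
      by (auto simp: PiE_iff)
    moreover have "strict_antimono_on {Suc j..r} (n(j := undefined))"
      using n(2) unfolding split monotone_on_def by auto
    moreover have "n j \<in> {0<..<N}" using n(1) assms by auto
    ultimately show "(n j, n(j := undefined)) \<in> Sigma {0<..<N} (chains (Suc j) r)"
      by (simp add: chains_def)
  qed
  finally show ?thesis by simp
qed

text \<open>Induction from the innermost sum outwards: a constant plus oscillating symbols is a form
  that survives multiplication by \<open>z j ^ m * g j m\<close> and summation over
  \<open>m\<close>. The inner stages need a smaller \<open>e\<close>.\<close>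

lemma nested_sum_expansion:
  fixes z :: "nat \<Rightarrow> complex" and g :: "nat \<Rightarrow> nat \<Rightarrow> complex" and \<sigma> :: "nat \<Rightarrow> real"
  assumes z: "\<And>i. i \<in> {1..r} \<Longrightarrow> norm (z i) = 1"
    and g: "\<And>i e. i \<in> {1..r} \<Longrightarrow> e > 0 \<Longrightarrow> symbol (e - \<sigma> i) (g i)"
    and g0: "\<And>i. g i 0 = 0"
    and "1 \<le> j" "j \<le> Suc r" "e > 0"
  shows "\<exists>C h. (\<forall>i\<in>{j..r}. symbol (e - (\<Sum>l=j..i. \<sigma> l) +
            real (card {l\<in>{j..i}. (\<Prod>k=l..i. z k) = 1})) (h i)) \<and>
          (\<forall>N. (\<Sum>n\<in>chains j r N. \<Prod>i=j..r. z i ^ n i * g i (n i)) =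
            C + (\<Sum>i=j..r. (\<Prod>l=j..i. z l) ^ N * h i N))"
  using \<open>j \<le> Suc r\<close> \<open>1 \<le> j\<close> \<open>e > 0\<close>
proof (induction j arbitrary: e rule: inc_induct)
  case base
  have "(\<Sum>n\<in>chains (Suc r) r N. \<Prod>i=Suc r..r. z i ^ n i * g i (n i)) = 1" for N
    by (simp add: chains_def monotone_on_def)
  then show ?case by auto
next
  case (step j)
  have jr: "j \<in> {1..r}" using step by auto
  define Z where "Z i = (\<Prod>l=j..i. z l)" for i
  define q where "q j i = real (card {l\<in>{j..i}. (\<Prod>k=l..i. z k) = 1})" for j i
  \<comment> \<open>The loss \<open>e\<close> is split in thirds: for the inner sum, for the factor
    \<open>g j\<close>, and for the gap demanded by \<open>partial_sum_symbol\<close>.\<close>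
  obtain C h where h:
    "\<And>i. i \<in> {Suc j..r} \<Longrightarrow> symbol (e / 3 - (\<Sum>l=Suc j..i. \<sigma> l) + q (Suc j) i) (h i)"
    "\<And>N. (\<Sum>n\<in>chains (Suc j) r N. \<Prod>i=Suc j..r. z i ^ n i * g i (n i)) =
            C + (\<Sum>i=Suc j..r. (\<Prod>l=Suc j..i. z l) ^ N * h i N)"
  proof -
    have "1 \<le> Suc j" "0 < e / 3" using step.prems by auto
    from step.IH[OF this] show ?thesis using that unfolding q_def by blast
  qed
  \<comment> \<open>Multiplication by \<open>z j ^ m * g j m\<close> turns the inner constant
    \<open>C\<close> into a new summand \<open>i = j\<close> and extends every inner block product
    to \<open>Z i\<close>.\<close>
  define u where "u i n = (if i = j then C * g j n else g j n * h i n)" for i n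
  have u: "symbol (e * 2 / 3 - (\<Sum>l=j..i. \<sigma> l) + q (Suc j) i) (u i)" if i: "i \<in> {j..r}" for i
  proof (cases "i = j")
    case True
    have "q (Suc j) j = 0" by (simp add: q_def)
    then show ?thesis using True symbol_cmult[OF g[OF jr, of "e * 2 / 3"], of C] step.prems
      by (simp add: u_def[abs_def])
  next
    case False
    with i have "i \<in> {Suc j..r}" "(\<Sum>l=j..i. \<sigma> l) = \<sigma> j + (\<Sum>l=Suc j..i. \<sigma> l)"
      by (auto simp: sum.atLeast_Suc_atMost)
    then show ?thesis using False symbol_mult[OF g[OF jr, of "e / 3"] h(1), of i] step.prems
      by (simp add: u_def[abs_def] algebra_simps)
  qed
  \<comment> \<open>Only the block starting at \<open>j\<close> is new; it counts exactly when
    summation against \<open>Z i\<close> raises the order by one.\<close>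
  have q: "q j i = q (Suc j) i + (if Z i = 1 then 1 else 0)" if "i \<in> {j..r}" for i
  proof -
    have "{l\<in>{j..i}. (\<Prod>k=l..i. z k) = 1} =
      (if Z i = 1 then insert j {l\<in>{Suc j..i}. (\<Prod>k=l..i. z k) = 1} else {l\<in>{Suc j..i}. (\<Prod>k=l..i. z k) = 1})"
    proof -
      have "{j..i} = insert j {Suc j..i}" using that by auto
      then have "l \<in> {j..i} \<longleftrightarrow> l = j \<or> l \<in> {Suc j..i}" for l by blast
      then show ?thesis unfolding Z_def by auto
    qed
    then show ?thesis by (simp add: q_def)
  qed
  have "\<exists>D H. symbol (e - (\<Sum>l=j..i. \<sigma> l) + q j i) H \<and>
      (\<forall>N. (\<Sum>n<N. Z i ^ n * u i n) = D + Z i ^ N * H N)" if i: "i \<in> {j..r}" for i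
  proof -
    have "norm (Z i) = 1"
      unfolding Z_def prod_norm[symmetric] using z i step.prems by (intro prod.neutral) auto
    then show ?thesis
      using partial_sum_symbol[OF u[OF i], of "Z i" "e - (\<Sum>l=j..i. \<sigma> l) + q (Suc j) i"] step.prems
      by (simp add: q[OF i] add.assoc)
  qed
  then obtain D H where DH: "\<And>i. i \<in> {j..r} \<Longrightarrow> symbol (e - (\<Sum>l=j..i. \<sigma> l) + q j i) (H i)"
      "\<And>i N. i \<in> {j..r} \<Longrightarrow> (\<Sum>n<N. Z i ^ n * u i n) = D i + Z i ^ N * H i N"
    by metis
  have "(\<Sum>n\<in>chains j r N. \<Prod>i=j..r. z i ^ n i * g i (n i)) =
      (\<Sum>i=j..r. D i) + (\<Sum>i=j..r. Z i ^ N * H i N)" for N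
  proof -
    have "(\<Sum>n\<in>chains j r N. \<Prod>i=j..r. z i ^ n i * g i (n i)) =
      (\<Sum>m\<in>{0<..<N}. z j ^ m * g j m * (C + (\<Sum>i=Suc j..r. (\<Prod>l=Suc j..i. z l) ^ m * h i m)))"
      using sum_chains_Suc[of j r "\<lambda>i m. z i ^ m * g i m" N] jr by (simp add: h(2))
    \<comment> \<open>Tuples have positive entries, but the term \<open>m = 0\<close> vanishes by
      \<open>g0\<close>, so the sum may start at zero.\<close>
    also have "\<dots> = (\<Sum>m<N. z j ^ m * g j m * (C + (\<Sum>i=Suc j..r. (\<Prod>l=Suc j..i. z l) ^ m * h i m)))"
      by (rule sum.mono_neutral_left) (auto simp: g0)
    also have "\<dots> = (\<Sum>m<N. \<Sum>i=j..r. Z i ^ m * u i m)"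
    proof (rule sum.cong)
      fix m
      have "Z i = z j * (\<Prod>l=Suc j..i. z l)" if "i \<ge> j" for i
        unfolding Z_def using that by (simp add: prod.atLeast_Suc_atMost)
      then have "z j ^ m * g j m * ((\<Prod>l=Suc j..i. z l) ^ m * h i m) = Z i ^ m * u i m"
        if "i \<in> {Suc j..r}" for i
        using that by (simp add: u_def power_mult_distrib)
      then have "z j ^ m * g j m * (\<Sum>i=Suc j..r. (\<Prod>l=Suc j..i. z l) ^ m * h i m) =
          (\<Sum>i=Suc j..r. Z i ^ m * u i m)"
        unfolding sum_distrib_left by (intro sum.cong) auto
      moreover have "(\<Sum>i=j..r. Z i ^ m * u i m) = Z j ^ m * u j m + (\<Sum>i=Suc j..r. Z i ^ m * u i m)"
        using jr by (simp add: sum.atLeast_Suc_atMost)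
      ultimately show "z j ^ m * g j m * (C + (\<Sum>i=Suc j..r. (\<Prod>l=Suc j..i. z l) ^ m * h i m)) =
          (\<Sum>i=j..r. Z i ^ m * u i m)"
        by (simp add: distrib_left u_def Z_def)
    qed simp
    also have "\<dots> = (\<Sum>i=j..r. \<Sum>m<N. Z i ^ m * u i m)" by (rule sum.swap)
    also have "\<dots> = (\<Sum>i=j..r. D i) + (\<Sum>i=j..r. Z i ^ N * H i N)"
      by (simp add: DH(2) sum.distrib)
    finally show ?thesis .
  qed
  with DH(1) show ?case
    by (intro exI[of _ "\<Sum>i=j..r. D i"] exI[of _ H] conjI ballI allI) (simp_all add: q_def Z_def)
qed

section \<open>Convergence from negative orders\<close>

lemma symbol_tendsto_0:
  assumes "symbol b f" "b < 0"
  shows "f \<longlonglongrightarrow> 0"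
proof -
  obtain K where "eventually (\<lambda>n. norm (f n) \<le> K * norm (npow b n)) sequentially"
    using symbol_bigo[OF assms(1)] by (elim landau_o.bigE)
  moreover have "(\<lambda>n. K * norm (npow b n)) \<longlonglongrightarrow> 0"
    using tendsto_mult_right_zero[OF tendsto_neg_powr[OF assms(2) filterlim_real_sequentially], of K]
    by simp
  ultimately show ?thesis by (rule Lim_null_comparison)
qed

lemma norm_root_of_unity:
  assumes "root_of_unity w"
  shows "norm w = 1"
proof -
  obtain m where "m > 0" "w ^ m = 1" using assms by (auto simp: root_of_unity_def)
  then show ?thesis by (metis norm_one norm_power norm_ge_zero power_eq_1_iff less_not_refl)
qed

lemma symbol_log_powr:
  assumes "e > 0"
  shows "symbol (e - Re s) (\<lambda>n. of_real (ln (real n)) ^ k / of_nat n powr s)"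
proof -
  \<comment> \<open>Each of the \<open>k\<close> logarithms costs \<open>d\<close>; dividing by
    \<open>Suc k\<close> also covers \<open>k = 0\<close>.\<close>
  define d where "d = e / real (Suc k)"
  have d: "d > 0" "real k * d \<le> e" using assms by (auto simp: d_def field_simps)
  have "symbol (real k * d + Re (- s)) (\<lambda>n. of_real (ln (real n)) ^ k * of_nat n powr (- s))"
    by (intro symbol_mult symbol_power symbol_ln symbol_powr d)
  then show ?thesis
    using d by (auto simp: powr_minus divide_inverse intro: symbol_mono)
qed

theorem theorem3:
  fixes r :: nat and z :: "nat \<Rightarrow> complex"
  assumes "r \<ge> 1"
    and "\<forall>i\<in>{1..r}. root_of_unity (z i)"
  shows "(\<forall>s \<in> V r z \<inter> integral_points r.
            convergent (\<lambda>N. multi_dirichlet_partial r z s N)) \<and>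
         (\<forall>s \<in> V r z \<inter> integral_points r. \<forall>k :: nat \<Rightarrow> nat.
            convergent (\<lambda>N. multi_dirichlet_log_partial r z s k N))"
proof -
  have conv: "convergent (\<lambda>N. multi_dirichlet_log_partial r z s k N)" if s: "s \<in> V r z" for s k
  proof -
    define g where "g i n = of_real (ln (real n)) ^ k i / of_nat n powr s i" for i n
    define gap where "gap i = (\<Sum>l=1..i. Re (s l)) - real (Q z i)" for i
    have gap: "gap i > 0" if "i \<in> {1..r}" for i
      using s that by (auto simp: V_def gap_def)
    \<comment> \<open>Half the least gap, so that every order \<open>e - gap i\<close> is
      negative.\<close>
    define e where "e = Min (gap ` {1..r}) / 2"
    have Min: "Min (gap ` {1..r}) > 0"
      using gap assms(1) by (subst Min_gr_iff) auto
    then have e: "e > 0" by (simp add: e_def)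
    have e_less: "e < gap i" if "i \<in> {1..r}" for i
    proof -
      have "Min (gap ` {1..r}) \<le> gap i" using that by (intro Min_le) auto
      then show ?thesis using Min by (simp add: e_def)
    qed
    have z: "norm (z i) = 1" if "i \<in> {1..r}" for i
      using assms(2) that norm_root_of_unity by blast
    obtain C h where h: "\<And>i. i \<in> {1..r} \<Longrightarrow> symbol (e - gap i) (h i)"
      "\<And>N. (\<Sum>n\<in>chains 1 r N. \<Prod>i=1..r. z i ^ n i * g i (n i)) =
          C + (\<Sum>i=1..r. (\<Prod>l=1..i. z l) ^ N * h i N)"
    proof -
      have Q: "card {l\<in>{1..i}. (\<Prod>k=l..i. z k) = 1} = Q z i" for i
        unfolding Q_def unit_block_starts_def by (rule arg_cong[where f = card]) auto
      have gap_eq: "e - (\<Sum>l=1..i. Re (s l)) + real (Q z i) = e - gap i" for i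
        by (simp add: gap_def)
      have g: "symbol (d - Re (s i)) (g i)" if "d > 0" for i d
        unfolding g_def using that by (rule symbol_log_powr)
      \<comment> \<open>Here \<open>0 powr s i = 0\<close>, and division by zero gives
        \<open>0\<close>.\<close>
      have g0: "g i 0 = 0" for i by (simp add: g_def)
      have r: "1 \<le> Suc r" by simp
      have "\<exists>C h. (\<forall>i\<in>{1..r}. symbol (e - gap i) (h i)) \<and>
          (\<forall>N. (\<Sum>n\<in>chains 1 r N. \<Prod>i=1..r. z i ^ n i * g i (n i)) =
            C + (\<Sum>i=1..r. (\<Prod>l=1..i. z l) ^ N * h i N))"
        using nested_sum_expansion[of r z "\<lambda>i. Re (s i)" g 1 e, OF z g g0 order.refl r e]
        unfolding Q gap_eq .
      then show ?thesis using that by blast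
    qed
    have "(\<lambda>N. \<Sum>i=1..r. (\<Prod>l=1..i. z l) ^ N * h i N) \<longlonglongrightarrow> (\<Sum>i=1..r. 0)"
    proof (rule tendsto_sum)
      fix i assume i: "i \<in> {1..r}"
      have "norm (\<Prod>l=1..i. z l) = 1"
        unfolding prod_norm[symmetric] using z i by (intro prod.neutral) auto
      then have "norm ((\<Prod>l=1..i. z l) ^ N * h i N) = norm (h i N)" for N
        by (simp add: norm_mult norm_power)
      moreover have "h i \<longlonglongrightarrow> 0"
        using symbol_tendsto_0[OF h(1)[OF i]] e_less[OF i] by simp
      ultimately have "(\<lambda>N. norm ((\<Prod>l=1..i. z l) ^ N * h i N)) \<longlonglongrightarrow> 0"
        using tendsto_norm_zero by simp
      then show "(\<lambda>N. (\<Prod>l=1..i. z l) ^ N * h i N) \<longlonglongrightarrow> 0"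
        by (rule tendsto_norm_zero_cancel)
    qed
    from tendsto_add[OF tendsto_const[of C] this]
    have "(\<lambda>N. \<Sum>n\<in>chains 1 r N. \<Prod>i=1..r. z i ^ n i * g i (n i)) \<longlonglongrightarrow> C + (\<Sum>i=1..r. 0)"
      unfolding h(2) .
    moreover have "multi_dirichlet_log_partial r z s k N =
        (\<Sum>n\<in>chains 1 r N. \<Prod>i=1..r. z i ^ n i * g i (n i))" for N
      by (simp add: multi_dirichlet_log_partial_def decreasing_tuples_def chains_def g_def)
    ultimately show ?thesis by (auto simp: convergent_def)
  qed
  have "multi_dirichlet_partial r z s = multi_dirichlet_log_partial r z s (\<lambda>_. 0)" for s
    by (simp add: multi_dirichlet_partial_def multi_dirichlet_log_partial_def fun_eq_iff)
  with conv show ?thesis by auto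
qed

end
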